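(* Fix $t>0$, $x_0\in\mathbb{R}$, $\theta>0$ and $\sigma>0$. For $\mu\in\mathbb{R}$ let $\gamma_{\mu}$ be the Gaussian probability measure on $\mathbb{R}$ with mean $m_t=x_0e^{-\theta t}+\mu(1-e^{-\theta t})$ and variance $\sigma_t^2=\frac{\sigma^2}{2\theta}\left(1-e^{-2\theta t}\right)$. For $n\in\mathbb{N}$ define $T_n^*:\mathbb{R}^n\to\mathbb{R}$ by $$T_n^*(z_1,\dots,z_n)=\left(\frac{\sum_{k=1}^n z_k}{n}-x_0e^{-\theta t}\right)\Big/\left(1-e^{-\theta t}\right).$$ Then the estimators $T_*^{(0)}:\mathbb{R}^{\infty}\to\mathbb{R}$ and $T_*^{(1)}:\mathbb{R}^{\infty}\to\mathbb{R}$ defined by $$T_*^{(0)}((z_k)_{k\in\mathbb{N}})=\liminf_{n\to\infty}T_n^*(z_1,\dots,z_n)\quad\text{and}\quad T_*^{(1)}((z_k)_{k\in\mathbb{N}})=\limsup_{n\to\infty}T_n^*(z_1,\dots,z_n)$$ are infinite-sample consistent estimators of the parameter $\mu\in\mathbb{R}$ (the equilibrium) for the family of probability measures $(\gamma_{\mu}^{\infty})_{\mu\in\mathbb{R}}$.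
   Context: $\mathbb{R}^\infty=\mathbb{R}^{\mathbb{N}}$ is the space of real sequences $(z_k)_{k\in\mathbb{N}}$, $\mathbb{N}=\{1,2,\dots\}$, with its Borel $\sigma$-algebra; for a Borel probability measure $\gamma$ on $\mathbb{R}$, $\gamma^{\infty}$ denotes the infinite product measure $\gamma\times\gamma\times\cdots$ on $\mathbb{R}^\infty$. Given a family $(\gamma_\vartheta)_{\vartheta\in\mathbb{R}}$ of Borel probability measures on $\mathbb{R}$, a Borel measurable function $T:\mathbb{R}^\infty\to\mathbb{R}$ is called an infinite-sample consistent estimator of the parameter $\vartheta$ for the family $(\gamma_\vartheta^\infty)_{\vartheta\in\mathbb{R}}$ if $\gamma_\vartheta^\infty(\{(z_k)_{k\in\mathbb{N}}\in\mathbb{R}^\infty: T((z_k)_{k\in\mathbb{N}})=\vartheta\})=1$ for every $\vartheta\in\mathbb{R}$. (The measure $\gamma_{\mu}$ is the law at time $t$ of the Ornstein-Uhlenbeck process $x_t=x_0e^{-\theta t}+\mu(1-e^{-\theta t})+\sigma\int_0^te^{-\theta(t-s)}dW_s$ with $W$ a Wiener process; the claim only uses $\gamma_{\mu}$ as defined in it.)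
   Formalization: The lower and upper limits can be infinite (e.g. for z_k = k), so the estimators are not real-valued on all of R^∞ as written; where a limit is infinite the estimator is given an arbitrary fixed real value c, and the claim is stated for every c. *)

theory Defs
  imports "HOL-Probability.Probability"
begin

text \<open>
  Sequences are indexed from 0: the value \<open>z k\<close> is the \<open>(k+1)\<close>-st coordinate.
  The space \<open>\<real>\<^sup>\<infinity>\<close> is the type \<^typ>\<open>nat \<Rightarrow> real\<close>, whose \<^const>\<open>borel\<close>
  sigma-algebra is that of the product topology.
\<close>

definition infinite_power :: "real measure \<Rightarrow> (nat \<Rightarrow> real) measure" where
  "infinite_power M = (\<Pi>\<^sub>M k\<in>UNIV. M)"

definition infinite_sample_consistent ::
    "(real \<Rightarrow> real measure) \<Rightarrow> ((nat \<Rightarrow> real) \<Rightarrow> real) \<Rightarrow> bool" where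
  "infinite_sample_consistent \<gamma> T \<longleftrightarrow>
     (\<forall>\<theta>. real_distribution (\<gamma> \<theta>)) \<and>
     T \<in> borel_measurable borel \<and>
     (\<forall>\<theta>. measure (infinite_power (\<gamma> \<theta>)) {z. T z = \<theta>} = 1)"

definition ou_mean :: "real \<Rightarrow> real \<Rightarrow> real \<Rightarrow> real \<Rightarrow> real" where
  "ou_mean t x0 \<theta> \<mu> = x0 * exp (- \<theta> * t) + \<mu> * (1 - exp (- \<theta> * t))"

definition ou_variance :: "real \<Rightarrow> real \<Rightarrow> real \<Rightarrow> real" where
  "ou_variance t \<theta> \<sigma> = \<sigma>\<^sup>2 / (2 * \<theta>) * (1 - exp (- 2 * \<theta> * t))"

text \<open>\<^const>\<open>normal_density\<close> takes the standard deviation, not the variance.\<close>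

definition ou_law :: "real \<Rightarrow> real \<Rightarrow> real \<Rightarrow> real \<Rightarrow> real \<Rightarrow> real measure" where
  "ou_law t x0 \<theta> \<sigma> \<mu> =
     density lborel (normal_density (ou_mean t x0 \<theta> \<mu>) (sqrt (ou_variance t \<theta> \<sigma>)))"

text \<open>
  Only the first \<open>n\<close> coordinates of \<open>z\<close> are used.  The value at \<open>n = 0\<close> is junk, and
  irrelevant for the limits below.
\<close>

definition equilibrium_estimator :: "real \<Rightarrow> real \<Rightarrow> real \<Rightarrow> nat \<Rightarrow> (nat \<Rightarrow> real) \<Rightarrow> real" where
  "equilibrium_estimator t x0 \<theta> n z =
     ((\<Sum>k<n. z k) / real n - x0 * exp (- \<theta> * t)) / (1 - exp (- \<theta> * t))"

text \<open>
  The lower and upper limits exist in the extended reals.  To obtain real-valued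
  estimators, an infinite limit is replaced by a real number \<open>c\<close>, which is left as a
  parameter: with a fixed choice, infinite limits would be counted as correct estimates
  when the true parameter equals \<open>c\<close>.
\<close>

definition finite_or :: "real \<Rightarrow> ereal \<Rightarrow> real" where
  "finite_or c x = (if \<bar>x\<bar> = \<infinity> then c else real_of_ereal x)"

definition liminf_estimator :: "real \<Rightarrow> real \<Rightarrow> real \<Rightarrow> real \<Rightarrow> (nat \<Rightarrow> real) \<Rightarrow> real" where
  "liminf_estimator c t x0 \<theta> z =
     finite_or c (liminf (\<lambda>n. ereal (equilibrium_estimator t x0 \<theta> n z)))"

definition limsup_estimator :: "real \<Rightarrow> real \<Rightarrow> real \<Rightarrow> real \<Rightarrow> (nat \<Rightarrow> real) \<Rightarrow> real" where
  "limsup_estimator c t x0 \<theta> z =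
     finite_or c (limsup (\<lambda>n. ereal (equilibrium_estimator t x0 \<theta> n z)))"

end

theory Submission
  imports Defs
begin

text \<open>
  The sum \<open>S\<^sub>n\<close> of \<open>n\<close> independent normal variables of mean \<open>m\<close> and standard deviation \<open>s\<close>
  is normal with mean \<open>n m\<close> and variance \<open>n s\<^sup>2\<close>, so the fourth moment of \<open>S\<^sub>n / n - m\<close> is
  \<open>3 s\<^sup>4 / n\<^sup>2\<close>.  This is summable in \<open>n\<close>; hence \<open>\<Sum>\<^sub>n (S\<^sub>n / n - m)\<^sup>4\<close> has finite expectation and
  is almost surely finite, and its terms tend to \<open>0\<close>.  The estimators are affine images of
  the sample mean, chosen so that the limit \<open>m\<^sub>t\<close> is sent to \<open>\<mu>\<close>.
\<close>

text \<open>For nonnegative terms, integral and sum can be exchanged even when the sum takes the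
  value infinity. A finite integral forces the sum to be finite almost everywhere, and the terms of
  a convergent series vanish in the limit.\<close>

lemma AE_tendsto_of_summable_integrals:
  fixes M :: "'a measure" and g :: "nat \<Rightarrow> 'a \<Rightarrow> real"
  assumes int: "\<And>n. integrable M (g n)"
    and nonneg: "\<And>n x. 0 \<le> g n x"
    and summable: "summable (\<lambda>n. \<integral>x. g n x \<partial>M)"
  shows "AE x in M. (\<lambda>n. g n x) \<longlonglongrightarrow> 0"
proof -
  note [measurable] = borel_measurable_integrable[OF int]
  have "(\<integral>\<^sup>+x. (\<Sum>n. ennreal (g n x)) \<partial>M) = (\<Sum>n. \<integral>\<^sup>+x. ennreal (g n x) \<partial>M)"
    by (rule nn_integral_suminf) measurable
  also have "\<dots> = (\<Sum>n. ennreal (\<integral>x. g n x \<partial>M))"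
    by (simp add: nn_integral_eq_integral int nonneg)
  also have "\<dots> \<noteq> \<infinity>"
    by (simp add: suminf_ennreal2 summable nonneg)
  finally have "AE x in M. (\<Sum>n. ennreal (g n x)) \<noteq> \<infinity>"
    by (intro nn_integral_PInf_AE) auto
  then show ?thesis
  proof eventually_elim
    case (elim x)
    then have "summable (\<lambda>n. g n x)"
      by (intro summable_suminf_not_top nonneg) simp
    then show ?case
      by (rule summable_LIMSEQ_zero)
  qed
qed

text \<open>The second moment of the centred sample mean is \<open>s^2 / n\<close>, whose series
  diverges; the fourth decays like \<open>1 / n^2\<close>. Normality of the sum gives it exactly,
  without expanding the fourth power of a sum.\<close>

lemma (in prob_space) sample_mean_normal_fourth_moment:
  fixes X :: "nat \<Rightarrow> 'a \<Rightarrow> real"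
  assumes indep: "indep_vars (\<lambda>_. borel) X UNIV"
    and normal: "\<And>k. distributed M lborel (X k) (normal_density m s)"
    and s: "0 < s" and n: "0 < n"
  shows "has_bochner_integral M (\<lambda>x. ((\<Sum>k<n. X k x) / real n - m) ^ 4) (3 * s ^ 4 / (real n)\<^sup>2)"
proof -
  \<comment> \<open>Variances of independent summands add up, so \<open>r\<close> is the standard
    deviation of the sum.\<close>
  define r where "r = sqrt (real n * s\<^sup>2)"
  have r: "0 < r" and r2: "r\<^sup>2 = real n * s\<^sup>2"
    using s n by (auto simp: r_def)
  have D: "distributed M lborel (\<lambda>x. \<Sum>k<n. X k x) (normal_density (real n * m) r)"
    using sum_indep_normal[of "{..<n}" X "\<lambda>_. s" "\<lambda>_. m"] indep_vars_subset[OF indep]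
      normal s n by (auto simp: r_def lessThan_empty_iff)
  \<comment> \<open>The central moment of order \<open>2 * k\<close> for \<open>k = 2\<close> is
    \<open>4! / (2^2 * 2!) = 3\<close> times \<open>r^4\<close>, and
    \<open>r^4 = n^2 * s^4\<close>.\<close>
  have moment: "has_bochner_integral lborel
      (\<lambda>y. normal_density (real n * m) r y * (y - real n * m) ^ 4) (3 * (real n)\<^sup>2 * s ^ 4)"
    using normal_moment_even[OF r, of "real n * m" 2]
    by (simp add: r2 fact_numeral power_divide power_mult_distrib mult_ac flip: power_mult)
  have "has_bochner_integral M (\<lambda>x. ((\<Sum>k<n. X k x) - real n * m) ^ 4) (3 * (real n)\<^sup>2 * s ^ 4)"
    using moment distributed_integrable[OF D, of "\<lambda>y. (y - real n * m) ^ 4"]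
      distributed_integral[OF D, of "\<lambda>y. (y - real n * m) ^ 4"]
    by (simp add: has_bochner_integral_iff)
  then have "has_bochner_integral M (\<lambda>x. ((\<Sum>k<n. X k x) - real n * m) ^ 4 / real n ^ 4)
      (3 * (real n)\<^sup>2 * s ^ 4 / real n ^ 4)"
    by (rule has_bochner_integral_divide_zero)
  moreover have "((\<Sum>k<n. X k x) - real n * m) ^ 4 / real n ^ 4 = ((\<Sum>k<n. X k x) / real n - m) ^ 4" for x
    using n by (simp add: diff_divide_distrib flip: power_divide)
  moreover have "3 * (real n)\<^sup>2 * s ^ 4 / real n ^ 4 = 3 * s ^ 4 / (real n)\<^sup>2"
    using n by (simp add: field_simps eval_nat_numeral)
  ultimately show ?thesis
    by simp
qed

lemma (in prob_space) strong_law_normal: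
  fixes X :: "nat \<Rightarrow> 'a \<Rightarrow> real"
  assumes indep: "indep_vars (\<lambda>_. borel) X UNIV"
    and normal: "\<And>k. distributed M lborel (X k) (normal_density m s)"
    and s: "0 < s"
  shows "AE x in M. (\<lambda>n. (\<Sum>k<n. X k x) / real n) \<longlonglongrightarrow> m"
proof -
  \<comment> \<open>The shift to \<open>Suc n\<close> avoids the empty sample mean, which division
    by zero makes \<open>0\<close> and to which the moment formula does not apply.
    \<open>LIMSEQ_imp_Suc\<close> undoes the shift at the end.\<close>
  let ?g = "\<lambda>n x. ((\<Sum>k<Suc n. X k x) / real (Suc n) - m) ^ 4"
  note moment = sample_mean_normal_fourth_moment[OF indep normal s zero_less_Suc]
  have "summable (\<lambda>n. 3 * s ^ 4 * (1 / (real (Suc n))\<^sup>2))"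
    using inverse_power_summable[of 2, where 'a = real]
    by (intro summable_mult) (subst summable_Suc_iff, simp add: inverse_eq_divide)
  then have "summable (\<lambda>n. \<integral>x. ?g n x \<partial>M)"
    by (simp add: has_bochner_integral_integral_eq[OF moment] del: sum.lessThan_Suc of_nat_Suc)
  then have "AE x in M. (\<lambda>n. ?g n x) \<longlonglongrightarrow> 0"
    by (intro AE_tendsto_of_summable_integrals integrable.intros[OF moment])
       (simp_all add: zero_le_even_power)
  then show ?thesis
  proof eventually_elim
    case (elim x)
    \<comment> \<open>Continuity of the fourth root turns convergence of the fourth powers into
      convergence of the absolute deviations.\<close>
    have "(\<lambda>n. root 4 (?g n x)) \<longlonglongrightarrow> root 4 0"
      by (intro tendsto_real_root elim)
    moreover have "root 4 (y ^ 4) = \<bar>y\<bar>" for y :: real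
      using real_root_power_cancel[of 4 "\<bar>y\<bar>"] by simp
    ultimately have "(\<lambda>n. \<bar>(\<Sum>k<Suc n. X k x) / real (Suc n) - m\<bar>) \<longlonglongrightarrow> 0"
      by (simp only: real_root_zero)
    then have "(\<lambda>n. (\<Sum>k<Suc n. X k x) / real (Suc n)) \<longlonglongrightarrow> m"
      by (simp only: tendsto_rabs_zero_iff flip: LIM_zero_iff[of _ m])
    then show ?case
      by (rule LIMSEQ_imp_Suc)
  qed
qed

text \<open>The reals are second countable, so the countable product of their Borel sigma-algebras
  is the Borel sigma-algebra of the product topology.\<close>

lemma sets_infinite_power:
  assumes "sets N = sets borel"
  shows "sets (infinite_power N) = sets borel"
proof -
  have "sets (infinite_power N) = sets (\<Pi>\<^sub>M k\<in>(UNIV :: nat set). (borel :: real measure))"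
    unfolding infinite_power_def by (intro sets_PiM_cong refl assms)
  then show ?thesis
    by (simp add: sets_PiM_equal_borel)
qed

lemma prob_space_infinite_power:
  assumes "prob_space N"
  shows "prob_space (infinite_power N)"
  unfolding infinite_power_def by (intro prob_space_PiM assms)

lemma distr_infinite_power_component:
  assumes "prob_space N" "sets N = sets borel"
  shows "distr (infinite_power N) borel (\<lambda>z. z k) = N"
proof -
  have "distr (infinite_power N) borel (\<lambda>z. z k) = distr (infinite_power N) N (\<lambda>z. z k)"
    by (intro distr_cong) (simp_all add: assms)
  also have "\<dots> = N"
    unfolding infinite_power_def by (intro distr_PiM_component assms) simp
  finally show ?thesis .
qed

text \<open>Independence means that the joint law is the product of the marginals. The coordinates
  jointly form the identity map, so their joint law is \<open>infinite_power N\<close> itself, and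
  each marginal is \<open>N\<close>.\<close>

lemma indep_vars_infinite_power:
  assumes N: "prob_space N" "sets N = sets borel"
  shows "prob_space.indep_vars (infinite_power N) (\<lambda>_. borel) (\<lambda>k z. z k) UNIV"
proof -
  interpret P: prob_space "infinite_power N"
    by (intro prob_space_infinite_power N)
  have sets: "sets (infinite_power N) = sets (\<Pi>\<^sub>M k\<in>(UNIV :: nat set). (borel :: real measure))"
    by (simp add: sets_infinite_power N sets_PiM_equal_borel)
  have "(\<lambda>z. z k) \<in> borel_measurable (infinite_power N)" for k
    unfolding measurable_cong_sets[OF sets refl] by simp
  moreover have "distr (infinite_power N) (\<Pi>\<^sub>M k\<in>UNIV. borel) (\<lambda>z. z) = infinite_power N"
    by (rule distr_id2[OF sets[symmetric]])
  ultimately show ?thesis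
    by (subst P.indep_vars_iff_distr_eq_PiM)
       (simp_all add: distr_infinite_power_component N restrict_UNIV, simp add: infinite_power_def)
qed

lemma strong_law_infinite_power_normal:
  fixes m s :: real
  assumes s: "0 < s"
  defines "N \<equiv> density lborel (normal_density m s)"
  shows "AE z in infinite_power N. (\<lambda>n. (\<Sum>k<n. z k) / real n) \<longlonglongrightarrow> m"
proof -
  have N: "prob_space N" "sets N = sets borel"
    using s by (simp_all add: N_def prob_space_normal_density)
  interpret P: prob_space "infinite_power N"
    by (intro prob_space_infinite_power N)
  have rv: "(\<lambda>z. z k) \<in> borel_measurable (infinite_power N)" for k
    using indep_vars_infinite_power[OF N] by (simp add: P.indep_vars_def)
  \<comment> \<open>\<open>distributed\<close> refers to a density with respect to
    \<open>lborel\<close>; as the target of \<open>distr\<close>, only its sigma-algebra matters,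
    and that is the one of \<open>borel\<close>.\<close>
  have "distr (infinite_power N) lborel (\<lambda>z. z k) = N" for k
    using distr_infinite_power_component[OF N, of k] by (simp cong: distr_cong)
  then have "distributed (infinite_power N) lborel (\<lambda>z. z k) (normal_density m s)" for k
    using rv by (simp add: distributed_def N_def)
  then show ?thesis
    by (intro P.strong_law_normal[OF indep_vars_infinite_power[OF N] _ s])
qed

text \<open>An almost sure event has measure one once it is known to be measurable. This follows
  from measurability of \<open>T\<close>, since the product measure lives on the Borel sets.\<close>

lemma infinite_sample_consistentI:
  assumes "\<And>\<theta>. real_distribution (\<gamma> \<theta>)"
    and T: "T \<in> borel_measurable borel"
    and ae: "\<And>\<theta>. AE z in infinite_power (\<gamma> \<theta>). T z = \<theta>"
  shows "infinite_sample_consistent \<gamma> T"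
  unfolding infinite_sample_consistent_def
proof (intro conjI allI assms)
  fix \<theta>
  interpret R: real_distribution "\<gamma> \<theta>" by fact
  have sets: "sets (infinite_power (\<gamma> \<theta>)) = sets borel"
    by (simp add: sets_infinite_power)
  interpret P: prob_space "infinite_power (\<gamma> \<theta>)"
    by (intro prob_space_infinite_power R.prob_space_axioms)
  have "{z. T z = \<theta>} \<in> sets (infinite_power (\<gamma> \<theta>))"
    unfolding sets using T by measurable
  then show "measure (infinite_power (\<gamma> \<theta>)) {z. T z = \<theta>} = 1"
    using ae[of \<theta>] by (subst P.prob_eq_1) auto
qed

lemma ou_variance_pos:
  assumes "0 < t" "0 < \<theta>" "0 < \<sigma>"
  shows "0 < ou_variance t \<theta> \<sigma>"
  using assms by (simp add: ou_variance_def)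

lemma real_distribution_ou_law:
  assumes "0 < t" "0 < \<theta>" "0 < \<sigma>"
  shows "real_distribution (ou_law t x0 \<theta> \<sigma> \<mu>)"
  using ou_variance_pos[OF assms]
  by (auto simp: ou_law_def real_distribution_def real_distribution_axioms_def
      prob_space_normal_density)

text \<open>The sample mean tends to \<open>ou_mean t x0 \<theta> \<mu>\<close>, and the estimator
  applies to it the inverse of the affine map taking \<mu> to this mean. The map is invertible
  because \<open>exp (- \<theta> * t) < 1\<close>.\<close>

lemma equilibrium_estimator_tendsto:
  assumes "0 < t" "0 < \<theta>" "0 < \<sigma>"
  shows "AE z in infinite_power (ou_law t x0 \<theta> \<sigma> \<mu>).
    (\<lambda>n. equilibrium_estimator t x0 \<theta> n z) \<longlonglongrightarrow> \<mu>"
proof -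
  have "AE z in infinite_power (ou_law t x0 \<theta> \<sigma> \<mu>).
      (\<lambda>n. (\<Sum>k<n. z k) / real n) \<longlonglongrightarrow> ou_mean t x0 \<theta> \<mu>"
    unfolding ou_law_def using ou_variance_pos[OF assms]
    by (intro strong_law_infinite_power_normal) simp
  then show ?thesis
  proof eventually_elim
    case (elim z)
    have ne: "1 - exp (- \<theta> * t) \<noteq> 0"
      using assms by simp
    have "(\<lambda>n. equilibrium_estimator t x0 \<theta> n z)
        \<longlonglongrightarrow> (ou_mean t x0 \<theta> \<mu> - x0 * exp (- \<theta> * t)) / (1 - exp (- \<theta> * t))"
      unfolding equilibrium_estimator_def by (intro tendsto_intros elim ne)
    also have "(ou_mean t x0 \<theta> \<mu> - x0 * exp (- \<theta> * t)) / (1 - exp (- \<theta> * t)) = \<mu>"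
      using ne by (simp add: ou_mean_def)
    finally show ?case .
  qed
qed

lemma borel_measurable_equilibrium_estimator [measurable]:
  "equilibrium_estimator t x0 \<theta> n \<in> borel_measurable borel"
proof -
  have [measurable]: "(\<lambda>z :: nat \<Rightarrow> real. z k) \<in> borel_measurable borel" for k
    by simp
  show ?thesis
    unfolding equilibrium_estimator_def[abs_def] by measurable
qed

lemma borel_measurable_finite_or [measurable]: "finite_or c \<in> borel_measurable borel"
  unfolding finite_or_def[abs_def] by measurable

theorem theorem3p2p1:
  fixes t x0 \<theta> \<sigma> c :: real
  assumes "t > 0" and "\<theta> > 0" and "\<sigma> > 0"
  shows "infinite_sample_consistent (ou_law t x0 \<theta> \<sigma>) (liminf_estimator c t x0 \<theta>) \<and>
         infinite_sample_consistent (ou_law t x0 \<theta> \<sigma>) (limsup_estimator c t x0 \<theta>)"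
proof (intro conjI infinite_sample_consistentI real_distribution_ou_law assms)
  show "liminf_estimator c t x0 \<theta> \<in> borel_measurable borel"
    unfolding liminf_estimator_def[abs_def] by measurable
  show "limsup_estimator c t x0 \<theta> \<in> borel_measurable borel"
    unfolding limsup_estimator_def[abs_def] by measurable
  fix \<mu>
  show "AE z in infinite_power (ou_law t x0 \<theta> \<sigma> \<mu>). liminf_estimator c t x0 \<theta> z = \<mu>"
    using equilibrium_estimator_tendsto[OF assms, of x0 \<mu>]
  proof eventually_elim
    case (elim z)
    \<comment> \<open>Where the estimators converge, the lower limit is the real number \<mu>, so
      \<open>finite_or\<close> returns it whatever \<open>c\<close> is; the default can occur only
      within a null set.\<close>
    then have "liminf (\<lambda>n. ereal (equilibrium_estimator t x0 \<theta> n z)) = ereal \<mu>"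
      by (intro lim_imp_Liminf) simp_all
    then show ?case
      by (simp add: liminf_estimator_def finite_or_def)
  qed
  show "AE z in infinite_power (ou_law t x0 \<theta> \<sigma> \<mu>). limsup_estimator c t x0 \<theta> z = \<mu>"
    using equilibrium_estimator_tendsto[OF assms, of x0 \<mu>]
  proof eventually_elim
    case (elim z)
    then have "limsup (\<lambda>n. ereal (equilibrium_estimator t x0 \<theta> n z)) = ereal \<mu>"
      by (intro lim_imp_Limsup) simp_all
    then show ?case
      by (simp add: limsup_estimator_def finite_or_def)
  qed
qed

end
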